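(* Let $(X,d)$ be a $T_1$ quasi-metric space that is also normal. Then the following statements are equivalent: (a) $(X,d)$ is a UC space; (b) every open cover of $(X,d)$ has a Lebesgue number.
   Context: A quasi-metric on a set $X$ is a function $d:X\times X\to\mathbb{R}$ with, for all $x,y,z\in X$: $d(x,y)\ge 0$ and $d(x,x)=0$; $d(x,y)=0=d(y,x)$ implies $x=y$; and $d(x,y)\le d(x,z)+d(z,y)$ (symmetry is not required). The forward topology $\tau(d)$ is generated by the forward balls $B^{+}(x,\epsilon)=\{y\in X: d(x,y)<\epsilon\}$. All topological notions for $(X,d)$ ($T_1$, normal, open, closed, etc.) refer to $\tau(d)$; normal means that disjoint closed sets can be separated by disjoint open sets ($T_1$ is assumed separately). A function $f:(X,d)\to(\mathbb{R},|\cdot|)$ is forward continuous if it is continuous for $\tau(d)$ and the usual topology of $\mathbb{R}$; it is uniformly continuous if for every $\epsilon>0$ there is $\delta>0$ such that $d(x,y)<\delta$ implies $|f(x)-f(y)|<\epsilon$. $(X,d)$ is a UC space if every forward continuous $f:(X,d)\to(\mathbb{R},|\cdot|)$ is uniformly continuous. A number $\delta>0$ is a Lebesgue number for an open cover $\mathcal{U}$ of $X$ if for every $x\in X$ the forward ball $B^{+}(x,\delta)$ is contained in some $U\in\mathcal{U}$. *)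

theory Defs
  imports "HOL-Analysis.Analysis"
begin

definition quasi_metric :: "'a set \<Rightarrow> ('a \<Rightarrow> 'a \<Rightarrow> real) \<Rightarrow> bool" where
  "quasi_metric X d \<longleftrightarrow>
     (\<forall>x\<in>X. \<forall>y\<in>X. 0 \<le> d x y) \<and>
     (\<forall>x\<in>X. d x x = 0) \<and>
     (\<forall>x\<in>X. \<forall>y\<in>X. d x y = 0 \<and> d y x = 0 \<longrightarrow> x = y) \<and>
     (\<forall>x\<in>X. \<forall>y\<in>X. \<forall>z\<in>X. d x y \<le> d x z + d z y)"

definition forward_ball :: "'a set \<Rightarrow> ('a \<Rightarrow> 'a \<Rightarrow> real) \<Rightarrow> 'a \<Rightarrow> real \<Rightarrow> 'a set" where
  "forward_ball X d x \<epsilon> = {y \<in> X. d x y < \<epsilon>}"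

definition forward_topology :: "'a set \<Rightarrow> ('a \<Rightarrow> 'a \<Rightarrow> real) \<Rightarrow> 'a topology" where
  "forward_topology X d = topology_generated_by {forward_ball X d x \<epsilon> |x \<epsilon>. x \<in> X \<and> 0 < \<epsilon>}"

definition forward_continuous :: "'a set \<Rightarrow> ('a \<Rightarrow> 'a \<Rightarrow> real) \<Rightarrow> ('a \<Rightarrow> real) \<Rightarrow> bool" where
  "forward_continuous X d f \<longleftrightarrow> continuous_map (forward_topology X d) euclideanreal f"

definition quasi_uniformly_continuous :: "'a set \<Rightarrow> ('a \<Rightarrow> 'a \<Rightarrow> real) \<Rightarrow> ('a \<Rightarrow> real) \<Rightarrow> bool" where
  "quasi_uniformly_continuous X d f \<longleftrightarrow>
     (\<forall>\<epsilon>>0. \<exists>\<delta>>0. \<forall>x\<in>X. \<forall>y\<in>X. d x y < \<delta> \<longrightarrow> \<bar>f x - f y\<bar> < \<epsilon>)"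

definition UC_space :: "'a set \<Rightarrow> ('a \<Rightarrow> 'a \<Rightarrow> real) \<Rightarrow> bool" where
  "UC_space X d \<longleftrightarrow> (\<forall>f. forward_continuous X d f \<longrightarrow> quasi_uniformly_continuous X d f)"

definition open_cover :: "'a set \<Rightarrow> ('a \<Rightarrow> 'a \<Rightarrow> real) \<Rightarrow> 'a set set \<Rightarrow> bool" where
  "open_cover X d \<U> \<longleftrightarrow> (\<forall>U\<in>\<U>. openin (forward_topology X d) U) \<and> \<Union>\<U> = X"

definition Lebesgue_number :: "'a set \<Rightarrow> ('a \<Rightarrow> 'a \<Rightarrow> real) \<Rightarrow> 'a set set \<Rightarrow> real \<Rightarrow> bool" where
  "Lebesgue_number X d \<U> \<delta> \<longleftrightarrow> 0 < \<delta> \<and> (\<forall>x\<in>X. \<exists>U\<in>\<U>. forward_ball X d x \<delta> \<subseteq> U)"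

lemma topspace_forward_topology:
  assumes "quasi_metric X d"
  shows "topspace (forward_topology X d) = X"
proof
  show "topspace (forward_topology X d) \<subseteq> X"
    by (auto simp: forward_topology_def forward_ball_def topology_generated_by_topspace)
  show "X \<subseteq> topspace (forward_topology X d)"
  proof
    fix x assume "x \<in> X"
    with assms have "x \<in> forward_ball X d x 1"
      by (simp add: quasi_metric_def forward_ball_def)
    with \<open>x \<in> X\<close> show "x \<in> topspace (forward_topology X d)"
      unfolding forward_topology_def topology_generated_by_topspace
      by (intro UnionI[where X = "forward_ball X d x 1"]) (auto intro!: exI[of _ x] exI[of _ 1])
  qed
qed

end

theory Submission
  imports Defs
begin

text \<open>
  If an open cover has no Lebesgue number, there are \<open>x n\<close> whose forward ball of radius
  \<open>1/(n+1)\<close> lies in no member of the cover. By the triangle inequality \<open>x\<close> has no cluster point,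
  so its range is closed and discrete, and every ball contains some \<open>y n \<noteq> x n\<close>. By Tietze there
  is a continuous \<open>F\<close> that is integer valued and injective on the range of \<open>x\<close> with
  \<open>F (x n) \<ge> n\<close>. Uniform continuity of \<open>F\<close> gives \<open>\<bar>F (x n) - F (y n)\<bar> < 1\<close> for large \<open>n\<close>, so
  \<open>y\<close> has no cluster point either and eventually avoids the range of \<open>x\<close>. A Urysohn function
  separating the \<open>x n\<close> from the \<open>y n\<close> is then not uniformly continuous.
\<close>

text \<open>The forward balls are only a subbasis by definition. The triangle inequality makes them
  a base: a point \<open>x\<close> of the ball around \<open>c\<close> of radius \<open>e\<close>
  has the slack \<open>e - d c x\<close> as a radius.\<close>

lemma forward_ball_subset_openin:
  assumes qm: "quasi_metric X d" and U: "openin (forward_topology X d) U" and x: "x \<in> U"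
  obtains \<epsilon> where "\<epsilon> > 0" "forward_ball X d x \<epsilon> \<subseteq> U"
proof -
  have "generate_topology_on {forward_ball X d x \<epsilon> |x \<epsilon>. x \<in> X \<and> 0 < \<epsilon>} U"
    using U by (simp add: forward_topology_def openin_topology_generated_by)
  then have "\<forall>x\<in>U. \<exists>\<epsilon>>0. forward_ball X d x \<epsilon> \<subseteq> U"
  proof induction
    case Empty
    show ?case by simp
  next
    case (Int a b)
    show ?case
    proof
      fix x assume "x \<in> a \<inter> b"
      then obtain e1 e2 where "e1 > 0" "forward_ball X d x e1 \<subseteq> a"
        "e2 > 0" "forward_ball X d x e2 \<subseteq> b"
        using Int.IH by blast
      then show "\<exists>\<epsilon>>0. forward_ball X d x \<epsilon> \<subseteq> a \<inter> b"
        by (intro exI[of _ "min e1 e2"]) (auto simp: forward_ball_def)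
    qed
  next
    case (UN K)
    then show ?case by (meson Union_iff Union_upper subset_trans)
  next
    case (Basis s)
    then obtain c e where s: "s = forward_ball X d c e" and c: "c \<in> X"
      by blast
    show ?case
    proof
      fix x assume "x \<in> s"
      then have x: "x \<in> X" "d c x < e" by (auto simp: s forward_ball_def)
      have "d c y \<le> d c x + d x y" if "y \<in> X" for y
        using qm c x that by (simp add: quasi_metric_def)
      then have "forward_ball X d x (e - d c x) \<subseteq> s"
        by (force simp: s forward_ball_def)
      then show "\<exists>\<epsilon>>0. forward_ball X d x \<epsilon> \<subseteq> s"
        using x by (intro exI[of _ "e - d c x"]) simp
    qed
  qed
  then show thesis using x that by blast
qed

lemma openin_forward_ball:
  assumes "x \<in> X" "0 < \<epsilon>"
  shows "openin (forward_topology X d) (forward_ball X d x \<epsilon>)"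
  unfolding forward_topology_def
  by (rule topology_generated_by_Basis) (use assms in blast)

text \<open>A point off the image has a neighbourhood containing only finitely many terms. Their
  values form a closed set in a T1 space, and removing it leaves a neighbourhood that misses the
  image.\<close>

lemma closedin_image_locally_finite:
  assumes t1: "t1_space T" and s: "\<And>n. n \<in> I \<Longrightarrow> s n \<in> topspace T"
    and lf: "\<And>z. z \<in> topspace T \<Longrightarrow> \<exists>U. openin T U \<and> z \<in> U \<and> finite {n \<in> I. s n \<in> U}"
  shows "closedin T (s ` I)"
  unfolding closedin_def
proof
  show "s ` I \<subseteq> topspace T" using s by blast
  show "openin T (topspace T - s ` I)"
  proof (subst openin_subopen, intro ballI)
    fix z assume z: "z \<in> topspace T - s ` I"
    then obtain U where U: "openin T U" "z \<in> U" and fin: "finite {n \<in> I. s n \<in> U}"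
      using lf by blast
    let ?F = "s ` {n \<in> I. s n \<in> U}"
    have "closedin T ?F"
      using t1 fin s unfolding t1_space_closedin_finite by blast
    then have "openin T (U - ?F)" using U by (simp add: openin_diff)
    moreover have "z \<in> U - ?F" "U - ?F \<subseteq> topspace T - s ` I"
      using z U openin_subset by auto
    ultimately show "\<exists>V. openin T V \<and> z \<in> V \<and> V \<subseteq> topspace T - s ` I" by blast
  qed
qed

text \<open>A Lebesgue number of the cover by preimages of intervals of radius
  \<open>\<epsilon>/2\<close> serves as \<open>\<delta>\<close>: both \<open>x\<close> and
  \<open>y\<close> lie in the forward ball around \<open>x\<close>, hence in one preimage.\<close>

lemma Lebesgue_number_imp_uniformly_continuous:
  assumes qm: "quasi_metric X d" and f: "forward_continuous X d f"
    and leb: "\<And>\<U>. open_cover X d \<U> \<Longrightarrow> \<exists>\<delta>. Lebesgue_number X d \<U> \<delta>"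
  shows "quasi_uniformly_continuous X d f"
  unfolding quasi_uniformly_continuous_def
proof (intro allI impI)
  fix \<epsilon> :: real assume \<epsilon>: "\<epsilon> > 0"
  let ?P = "\<lambda>t. {x \<in> X. f x \<in> ball t (\<epsilon>/2)}"
  have "openin (forward_topology X d) (?P t)" for t
    using f openin_continuous_map_preimage[of "forward_topology X d" euclideanreal f "ball t (\<epsilon>/2)"]
    by (simp add: forward_continuous_def topspace_forward_topology[OF qm])
  moreover have "\<Union>(range ?P) = X"
    proof (intro equalityI subsetI)
    fix x assume "x \<in> X"
    with \<epsilon> have "x \<in> ?P (f x)" by simp
    then show "x \<in> \<Union>(range ?P)" by blast
  qed auto
  ultimately have "open_cover X d (range ?P)"
    by (auto simp: open_cover_def)
  then obtain \<delta> where \<delta>: "\<delta> > 0"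
    and sub: "\<And>x. x \<in> X \<Longrightarrow> \<exists>t. forward_ball X d x \<delta> \<subseteq> ?P t"
    using leb unfolding Lebesgue_number_def by blast
  have "\<bar>f x - f y\<bar> < \<epsilon>" if xy: "x \<in> X" "y \<in> X" "d x y < \<delta>" for x y
  proof -
    obtain t where "forward_ball X d x \<delta> \<subseteq> ?P t" using sub xy by blast
    moreover have "x \<in> forward_ball X d x \<delta>" "y \<in> forward_ball X d x \<delta>"
      using qm xy \<delta> by (auto simp: forward_ball_def quasi_metric_def)
    ultimately have "dist t (f x) < \<epsilon>/2" "dist t (f y) < \<epsilon>/2" by auto
    then show ?thesis unfolding dist_real_def by linarith
  qed
  with \<delta> show "\<exists>\<delta>>0. \<forall>x\<in>X. \<forall>y\<in>X. d x y < \<delta> \<longrightarrow> \<bar>f x - f y\<bar> < \<epsilon>" by blast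
qed

lemma quasi_uniformly_continuous_eventually:
  assumes "quasi_uniformly_continuous X d f" "\<epsilon> > 0"
    and "\<And>n. x n \<in> X" "\<And>n. y n \<in> X" "\<And>n. d (x n) (y n) < inverse (Suc n)"
  obtains N where "\<And>n. n \<ge> N \<Longrightarrow> \<bar>f (x n) - f (y n)\<bar> < \<epsilon>"
proof -
  obtain \<delta> where \<delta>: "\<delta> > 0" "\<And>u v. u \<in> X \<Longrightarrow> v \<in> X \<Longrightarrow> d u v < \<delta> \<Longrightarrow> \<bar>f u - f v\<bar> < \<epsilon>"
    using assms(1,2) unfolding quasi_uniformly_continuous_def by blast
  obtain N where N: "inverse (Suc N) < \<delta>" using reals_Archimedean[OF \<delta>(1)] by blast
  have "\<bar>f (x n) - f (y n)\<bar> < \<epsilon>" if "n \<ge> N" for n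
  proof -
    have "inverse (Suc n) \<le> inverse (Suc N)" using that by (simp add: field_simps)
    then have "d (x n) (y n) < \<delta>" using assms(5)[of n] N by linarith
    then show ?thesis using \<delta> assms by blast
  qed
  then show thesis by (rule that)
qed

text \<open>Local finiteness makes every subset of the range of \<open>x\<close> closed, so any real
  function on the range is continuous there and extends by Tietze. It remains to choose a suitable
  one.\<close>

lemma continuous_extension_tending_to_infinity:
  fixes x :: "nat \<Rightarrow> 'a"
  assumes t1: "t1_space T" and nrm: "normal_space T" and x: "\<And>n. x n \<in> topspace T"
    and lf: "\<And>z. z \<in> topspace T \<Longrightarrow> \<exists>U. openin T U \<and> z \<in> U \<and> finite {n. x n \<in> U}"
  obtains F where "continuous_map T euclideanreal F" "\<And>n. F (x n) \<in> \<nat>" "\<And>n. real n \<le> F (x n)"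
    "\<And>m n. F (x m) = F (x n) \<Longrightarrow> x m = x n"
proof -
  have closed: "closedin T (x ` I)" for I
  proof (rule closedin_image_locally_finite[OF t1 x])
    fix z assume "z \<in> topspace T"
    then obtain U where "openin T U" "z \<in> U" "finite {n. x n \<in> U}" using lf by blast
    then show "\<exists>U. openin T U \<and> z \<in> U \<and> finite {n \<in> I. x n \<in> U}" by auto
  qed
  \<comment> \<open>The sequence may repeat values, so a point is sent to its last index. This is at
    least every index of the point, and \<open>x\<close> recovers the point from it, which gives
    injectivity.\<close>
  define h where "h a = Max {n. x n = a}" for a
  have fin: "finite {n. x n = x m}" for m
  proof -
    obtain U where "x m \<in> U" "finite {n. x n \<in> U}" using lf x by blast
    then show ?thesis by (elim finite_subset[rotated]) auto
  qed
  have xh: "x (h (x m)) = x m" for m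
    using Max_in[OF fin[of m]] by (auto simp: h_def)
  have h_ge: "m \<le> h (x m)" for m
    unfolding h_def by (rule Max_ge[OF fin]) simp
  have "continuous_map (subtopology T (range x)) euclideanreal (\<lambda>a. real (h a))"
    unfolding continuous_map_closedin
  proof (intro conjI allI impI)
    fix C :: "real set"
    let ?P = "{a \<in> topspace (subtopology T (range x)). real (h a) \<in> C}"
    have P: "?P = x ` {n. real (h (x n)) \<in> C}" using x by auto
    show "closedin (subtopology T (range x)) ?P"
      unfolding P using closed by (intro closedin_subset_topspace) auto
  qed auto
  then obtain F where F: "continuous_map T euclideanreal F"
      "\<And>a. a \<in> range x \<Longrightarrow> F a = real (h a)"
    using Tietze_extension_realinterval[OF nrm closed[of UNIV], of UNIV "\<lambda>a. real (h a)"]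
    by auto
  show thesis
  proof (rule that[OF F(1)])
    show "x m = x n" if "F (x m) = F (x n)" for m n
      using that F(2) xh by (metis of_nat_eq_iff rangeI)
  qed (use F(2) h_ge in auto)
qed

lemma UC_space_imp_Lebesgue_number:
  assumes qm: "quasi_metric X d" and t1: "t1_space (forward_topology X d)"
    and nrm: "normal_space (forward_topology X d)" and UC: "UC_space X d"
    and cover: "open_cover X d \<U>"
  shows "\<exists>\<delta>. Lebesgue_number X d \<U> \<delta>"
proof (rule ccontr)
  let ?T = "forward_topology X d"
  have top: "topspace ?T = X" by (rule topspace_forward_topology[OF qm])
  assume "\<nexists>\<delta>. Lebesgue_number X d \<U> \<delta>"
  then have "\<exists>x\<in>X. \<forall>U\<in>\<U>. \<not> forward_ball X d x (inverse (Suc n)) \<subseteq> U" for n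
    unfolding Lebesgue_number_def by (metis inverse_positive_iff_positive of_nat_0_less_iff zero_less_Suc)
  then obtain x where xX: "\<And>n. x n \<in> X"
    and bad: "\<And>n U. U \<in> \<U> \<Longrightarrow> \<not> forward_ball X d (x n) (inverse (Suc n)) \<subseteq> U"
    by metis
  have "\<exists>y\<in>X. d (x n) y < inverse (Suc n) \<and> y \<noteq> x n" for n
  proof -
    obtain U where "U \<in> \<U>" "x n \<in> U" using cover xX unfolding open_cover_def by blast
    then show ?thesis using bad[of U n] by (auto simp: forward_ball_def)
  qed
  then obtain y where yX: "\<And>n. y n \<in> X" and dxy: "\<And>n. d (x n) (y n) < inverse (Suc n)"
    and y_ne: "\<And>n. y n \<noteq> x n"
    by metis
  have x_lf: "\<exists>V. openin ?T V \<and> z \<in> V \<and> finite {n. x n \<in> V}" if "z \<in> topspace ?T" for z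
  proof -
    have z: "z \<in> X" using that top by simp
    then obtain U where U: "U \<in> \<U>" "z \<in> U" "openin ?T U"
      using cover unfolding open_cover_def by blast
    then obtain e where e: "e > 0" "forward_ball X d z e \<subseteq> U"
      using forward_ball_subset_openin[OF qm] by blast
    obtain N where N: "inverse (Suc N) < e/2" using reals_Archimedean[of "e/2"] e by auto
    \<comment> \<open>Half the radius leaves room: if \<open>x n\<close> is in \<open>?V\<close> and
      \<open>inverse (Suc n) < e/2\<close>, the bad ball around \<open>x n\<close> lies in the ball
      of radius \<open>e\<close>, hence in \<open>U\<close>.\<close>
    let ?V = "forward_ball X d z (e/2)"
    have "n \<le> N" if n: "x n \<in> ?V" for n
    proof (rule ccontr)
      assume "\<not> n \<le> N"
      then have "inverse (Suc n) \<le> inverse (Suc N)" by (simp add: field_simps)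
      then have n2: "inverse (Suc n) < e/2" using N by linarith
      have "d z w \<le> d z (x n) + d (x n) w" if "w \<in> X" for w
        using qm z xX that by (simp add: quasi_metric_def)
      then have "forward_ball X d (x n) (inverse (Suc n)) \<subseteq> forward_ball X d z e"
        using n n2 by (force simp: forward_ball_def)
      then show False using bad U e by blast
    qed
    then have "finite {n. x n \<in> ?V}"
      by (meson finite_nat_set_iff_bounded_le mem_Collect_eq)
    moreover have "z \<in> ?V" using z e qm by (auto simp: forward_ball_def quasi_metric_def)
    ultimately show ?thesis using openin_forward_ball[OF z, of "e/2"] e by auto
  qed
  obtain F where F: "continuous_map ?T euclideanreal F" and F_Nats: "\<And>n. F (x n) \<in> \<nat>"
    and F_ge: "\<And>n. real n \<le> F (x n)" and F_inj: "\<And>m n. F (x m) = F (x n) \<Longrightarrow> x m = x n"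
    by (rule continuous_extension_tending_to_infinity[OF t1 nrm _ x_lf]) (auto simp: top xX)
  have "quasi_uniformly_continuous X d F"
    using UC F by (simp add: UC_space_def forward_continuous_def)
  then obtain N where N: "\<And>n. n \<ge> N \<Longrightarrow> \<bar>F (x n) - F (y n)\<bar> < 1"
    using quasi_uniformly_continuous_eventually[OF _ zero_less_one xX yX dxy] by blast
  have y_notin: "y n \<noteq> x m" if n: "n \<ge> N" for n m
  proof
    assume eq: "y n = x m"
    obtain i j where ij: "F (x n) = real i" "F (x m) = real j" using F_Nats by (metis Nats_cases)
    \<comment> \<open>Two natural numbers less than 1 apart are equal; injectivity then forces
      \<open>y n = x n\<close>.\<close>
    then have "i = j" using N[OF n] eq by simp
    then show False using F_inj[of m n] ij eq y_ne[of n] by simp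
  qed
  have clx: "closedin ?T (range x)"
    using closedin_image_locally_finite[OF t1, of UNIV x] x_lf xX top by simp
  have cly: "closedin ?T (y ` {N..})"
  proof (rule closedin_image_locally_finite[OF t1])
    show "y n \<in> topspace ?T" for n using yX top by simp
    fix z assume z: "z \<in> topspace ?T"
    \<comment> \<open>If \<open>y n\<close> is in \<open>?V\<close> and \<open>n \<ge> N\<close>,
      then \<open>n \<le> F (x n) < F (y n) + 1 < F z + 2\<close>, which bounds
      \<open>n\<close>.\<close>
    let ?V = "{w \<in> topspace ?T. F w \<in> {..< F z + 1}}"
    have "openin ?T ?V"
      using openin_continuous_map_preimage[OF F, of "{..< F z + 1}"] by simp
    moreover have "n \<le> nat \<lceil>F z + 2\<rceil>" if "n \<ge> N" "y n \<in> ?V" for n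
      using N[of n] F_ge[of n] that by simp linarith
    then have "finite {n \<in> {N..}. y n \<in> ?V}"
      by (intro finite_subset[OF _ finite_atMost[of "nat \<lceil>F z + 2\<rceil>"]]) auto
    ultimately show "\<exists>V. openin ?T V \<and> z \<in> V \<and> finite {n \<in> {N..}. y n \<in> V}"
      using z by (intro exI[of _ ?V]) auto
  qed
  have "disjnt (range x) (y ` {N..})"
    unfolding disjnt_iff using y_notin by (metis atLeast_iff imageE)
  then obtain g where g: "continuous_map ?T (top_of_set {0..1}) g"
      "g ` range x \<subseteq> {0::real}" "g ` (y ` {N..}) \<subseteq> {1}"
    using Urysohn_lemma[OF nrm clx cly, of 0 1] by auto
  then have "quasi_uniformly_continuous X d g"
    using UC by (simp add: UC_space_def forward_continuous_def continuous_map_in_subtopology)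
  then obtain M where M: "\<And>n. n \<ge> M \<Longrightarrow> \<bar>g (x n) - g (y n)\<bar> < 1"
    using quasi_uniformly_continuous_eventually[OF _ zero_less_one xX yX dxy] by blast
  \<comment> \<open>The index must reach \<open>N\<close> for \<open>g\<close> to be 1 at
    \<open>y\<close>, and \<open>M\<close> for the uniform estimate to apply.\<close>
  have "g (x (max M N)) = 0" "g (y (max M N)) = 1"
    using g by (auto simp: image_subset_iff)
  with M[of "max M N"] show False by simp
qed

theorem theorem4p10:
  fixes X :: "'a set" and d :: "'a \<Rightarrow> 'a \<Rightarrow> real"
  assumes "quasi_metric X d"
    and "t1_space (forward_topology X d)"
    and "normal_space (forward_topology X d)"
  shows "UC_space X d \<longleftrightarrow> (\<forall>\<U>. open_cover X d \<U> \<longrightarrow> (\<exists>\<delta>. Lebesgue_number X d \<U> \<delta>))"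
  using UC_space_imp_Lebesgue_number[OF assms] Lebesgue_number_imp_uniformly_continuous[OF assms(1)]
  unfolding UC_space_def by blast

end
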